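(* Let $l\in\mathbb{N}$ with $l\equiv1\pmod2$, $h\in\mathbb{Z}$, $k\in\mathbb{N}$, $m\ge0$ an integer and $x\in\mathbb{Z}_p$. Then $$E_{m,q}^{(h,k)}(lx)=\frac{[l]_q^m}{[l]_{-q}^k}\sum_{i_1,\dots,i_k=0}^{l-1}q^{h\sum_{j=1}^k i_j-\sum_{j=2}^k(j-1)i_j}(-1)^{\sum_{j=1}^k i_j}E_{m,q^l}^{(h,k)}\Big(x+\frac{i_1+\cdots+i_k}{l}\Big).$$
   Context: Let $p$ be an odd prime, $\mathbb{C}_p$ the completion of the algebraic closure of $\mathbb{Q}_p$, with $|p|_p=p^{-1}$. Let $q\in\mathbb{C}_p$ with $|1-q|_p<p^{-1/(p-1)}$. For $Q\in\{q,q^l\}$ and $x\in\mathbb{Z}_p$ put $Q^x=\exp(x\log Q)$, $[x]_Q=\frac{1-Q^x}{1-Q}$, $[2]_Q=1+Q$, and $[l]_{-q}=\frac{1-(-q)^l}{1+q}$. For $f:\mathbb{Z}_p\to\mathbb{C}_p$ (uniformly differentiable) define $$\int_{\mathbb{Z}_p}f(x)\,d\mu_{-Q}(x)=\lim_{N\to\infty}\frac{[2]_Q}{1+Q^{p^N}}\sum_{x=0}^{p^N-1}f(x)(-1)^xQ^x;$$ multiple integrals are iterated. For $h\in\mathbb{Z}$, $k\in\mathbb{N}$, integers $m\ge0$ define $$E_{m,Q}^{(h,k)}(y)=\int_{\mathbb{Z}_p}\cdots\int_{\mathbb{Z}_p}[y+x_1+\cdots+x_k]_Q^m\,Q^{(h-1)x_1+(h-2)x_2+\cdots+(h-k)x_k}\,d\mu_{-Q}(x_1)\cdots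 d\mu_{-Q}(x_k).$$ When $Q=q^l$ and the argument $y$ satisfies $ly\in\mathbb{Z}_p$, the power $(q^l)^{y+x_1+\cdots+x_k}$ is understood as $q^{ly+l(x_1+\cdots+x_k)}$. *)

theory Defs
  imports "HOL-Analysis.Analysis" "HOL-Computational_Algebra.Polynomial"
    "HOL-Computational_Algebra.Primes" "HOL-Library.FuncSet"
begin

class nonarch_complete_field = field_char_0 + complete_space +
  fixes absval :: "'a \<Rightarrow> real"
  assumes dist_absval: "dist x y = absval (x - y)"
    and absval_mult: "absval (x * y) = absval x * absval y"
    and absval_add: "absval (x + y) \<le> max (absval x) (absval y)"

text \<open>
  In a complete field of characteristic 0 whose absolute value is \<open>p\<close>-adic on the rationals, the
  topological closure of the prime field is (a copy of) the completion of the rationals for that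
  absolute value.
\<close>

definition Qp :: "'a::nonarch_complete_field set" where
  "Qp = closure \<rat>"

definition Zp :: "'a::nonarch_complete_field set" where
  "Zp = {x \<in> Qp. absval x \<le> 1}"

definition Qp_bar :: "'a::nonarch_complete_field set" where
  "Qp_bar = {x. \<exists>f. f \<noteq> 0 \<and> (\<forall>i. coeff f i \<in> Qp) \<and> poly f x = 0}"

text \<open>
  The type \<open>'a\<close> is the completion of an algebraic closure of \<open>Qp\<close>, with \<open>\<bar>p\<bar> = 1/p\<close>: it is
  complete, the elements algebraic over \<open>Qp\<close> are algebraically closed, and they are dense. This
  determines \<open>'a\<close> up to isometric isomorphism.
\<close>

definition is_Cp :: "nat \<Rightarrow> 'a::nonarch_complete_field itself \<Rightarrow> bool" where
  "is_Cp p T \<longleftrightarrow>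
     absval (of_nat p :: 'a) = 1 / real p \<and>
     (\<forall>f :: 'a poly. (\<forall>i. coeff f i \<in> Qp_bar) \<and> degree f > 0 \<longrightarrow> (\<exists>x\<in>Qp_bar. poly f x = 0)) \<and>
     closure (Qp_bar :: 'a set) = UNIV"

definition Cp_exp :: "'a::nonarch_complete_field \<Rightarrow> 'a" where
  "Cp_exp z = (\<Sum>n. z ^ n / fact n)"

definition Cp_log :: "'a::nonarch_complete_field \<Rightarrow> 'a" where
  "Cp_log u = (\<Sum>n. (-1) ^ n * (u - 1) ^ Suc n / of_nat (Suc n))"

text \<open>
  The exponent may be any element of the field for which the exponential series converges. Since
  \<open>Cp_log (q ^ l) = of_nat l * Cp_log q\<close>, the value \<open>Qpow (q ^ l) y\<close> is \<open>Qpow q (of_nat l * y)\<close>,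
  which is the intended meaning when only \<open>of_nat l * y\<close>, but not \<open>y\<close>, lies in \<open>Zp\<close>.
\<close>

definition Qpow :: "'a::nonarch_complete_field \<Rightarrow> 'a \<Rightarrow> 'a" where
  "Qpow Q x = Cp_exp (x * Cp_log Q)"

definition Qbracket :: "'a::nonarch_complete_field \<Rightarrow> 'a \<Rightarrow> 'a" where
  "Qbracket Q x = (1 - Qpow Q x) / (1 - Q)"

definition Qbracket_neg :: "'a::nonarch_complete_field \<Rightarrow> nat \<Rightarrow> 'a" where
  "Qbracket_neg q l = (1 - (- q) ^ l) / (1 + q)"

definition fermionic_integral ::
  "nat \<Rightarrow> 'a::nonarch_complete_field \<Rightarrow> ('a \<Rightarrow> 'a) \<Rightarrow> 'a" where
  "fermionic_integral p Q f =
     lim (\<lambda>N. (1 + Q) / (1 + Q ^ (p ^ N)) * (\<Sum>x<p ^ N. f (of_nat x) * (-1) ^ x * Q ^ x))"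

text \<open>The variables are \<open>x 1, \<dots>, x k\<close>, with \<open>x 1\<close> innermost.\<close>

primrec iterated_integral ::
  "nat \<Rightarrow> 'a::nonarch_complete_field \<Rightarrow> nat \<Rightarrow> ((nat \<Rightarrow> 'a) \<Rightarrow> 'a) \<Rightarrow> 'a" where
  "iterated_integral p Q 0 F = F (\<lambda>_. 0)"
| "iterated_integral p Q (Suc k) F =
     fermionic_integral p Q (\<lambda>t. iterated_integral p Q k (\<lambda>x. F (x(Suc k := t))))"

definition qEuler ::
  "nat \<Rightarrow> 'a::nonarch_complete_field \<Rightarrow> int \<Rightarrow> nat \<Rightarrow> nat \<Rightarrow> 'a \<Rightarrow> 'a" where
  "qEuler p Q h k m y =
     iterated_integral p Q k
       (\<lambda>x. Qbracket Q (y + (\<Sum>j=1..k. x j)) ^ m * Qpow Q (\<Sum>j=1..k. of_int (h - int j) * x j))"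

end

theory Submission
  imports Defs
begin

text \<open>
  If the integrand is an exponential \<open>x \<mapsto> a^x\<close>, the sums defining the fermionic integral are geometric
  and the integral equals \<open>(1 + Q)/(1 + Q a)\<close>. Expanding \<open>[y + x\<^sub>1 + \<dots> + x\<^sub>k]\<^sub>Q^m\<close> by the binomial
  theorem thus gives
  \<open>E(y) = (1 - Q)^(-m) \<Sum>\<^sub>s (m choose s) (-Q^y)^s \<Prod>\<^sub>j (1 + Q)/(1 + Q^(h-j+1+s))\<close>, and the theorem
  becomes a comparison of coefficients in which the sum over \<open>i\<^sub>1, \<dots>, i\<^sub>k\<close> is a product of geometric
  sums of odd length \<open>l\<close>.

  The analytic input is that \<open>Qpow\<close> extends ordinary powers and that \<open>log (q^l) = l log q\<close>. Both follow
  from \<open>log u = lim (u^P - 1)/P\<close> for \<open>P = p^N\<close>: this makes \<open>log\<close> additive and gives \<open>log (exp z) = z\<close>;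
  since \<open>log\<close> is injective on the disc of convergence of \<open>exp\<close>, also \<open>exp (log q) = q\<close>.
\<close>

section \<open>Ultrametric fields\<close>

lemma absval_eq_dist: "absval (x - y) = dist x (y :: 'a::nonarch_complete_field)"
  by (simp add: dist_absval)

lemma absval_dist_0: "absval (x :: 'a::nonarch_complete_field) = dist x 0"
  by (simp add: dist_absval)

lemma absval_nonneg [simp]: "0 \<le> absval (x :: 'a::nonarch_complete_field)"
  by (simp add: absval_dist_0)

lemma absval_0 [simp]: "absval (0 :: 'a::nonarch_complete_field) = 0"
  by (simp add: absval_dist_0)

lemma absval_eq_0_iff [simp]: "absval (x :: 'a::nonarch_complete_field) = 0 \<longleftrightarrow> x = 0"
  by (simp add: absval_dist_0)

lemma absval_pos_iff [simp]: "0 < absval (x :: 'a::nonarch_complete_field) \<longleftrightarrow> x \<noteq> 0"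
  by (simp add: absval_dist_0)

lemma absval_1 [simp]: "absval (1 :: 'a::nonarch_complete_field) = 1"
  using absval_mult[of "1::'a" 1] by simp

lemma absval_minus_commute: "absval (x - y) = absval (y - (x :: 'a::nonarch_complete_field))"
  by (simp add: absval_eq_dist dist_commute)

lemma absval_minus [simp]: "absval (- x) = absval (x :: 'a::nonarch_complete_field)"
  using absval_minus_commute[of 0 x] by simp

lemma absval_diff: "absval (x - y) \<le> max (absval x) (absval (y :: 'a::nonarch_complete_field))"
  using absval_add[of x "- y"] by simp

lemma absval_power: "absval (x ^ n) = absval (x :: 'a::nonarch_complete_field) ^ n"
  by (induction n) (auto simp: absval_mult)

lemma absval_divide: "absval (x / y) = absval x / absval (y :: 'a::nonarch_complete_field)"
proof (cases "y = 0")
  case False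
  then show ?thesis
    using absval_mult[of "x / y" y] by (simp add: field_simps)
qed simp

text \<open>The bound does not grow with the number of terms. The hypothesis
  \<open>0 \<le> B\<close> covers the empty sum and sums over infinite index sets, which are
  0.\<close>

lemma absval_sum_le:
  fixes f :: "'b \<Rightarrow> 'a::nonarch_complete_field"
  assumes "\<And>i. i \<in> I \<Longrightarrow> absval (f i) \<le> B" and "0 \<le> B"
  shows "absval (sum f I) \<le> B"
  using assms(1)
proof (induction I rule: infinite_finite_induct)
  case (insert i I)
  then show ?case
    using absval_add[of "f i" "sum f I"] by fastforce
qed (use assms(2) in auto)

lemma absval_of_nat_le_1: "absval (of_nat n :: 'a::nonarch_complete_field) \<le> 1"
  using absval_sum_le[of "{..<n}" "\<lambda>_. 1 :: 'a" 1] by simp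

lemma absval_of_int_le_1: "absval (of_int n :: 'a::nonarch_complete_field) \<le> 1"
  by (cases n rule: int_cases2) (auto simp: absval_of_nat_le_1)

section \<open>Limits and continuity of the field operations\<close>

lemma tendsto_absval_iff:
  "(f \<longlongrightarrow> a) F \<longleftrightarrow> ((\<lambda>x. absval (f x - a :: 'a::nonarch_complete_field)) \<longlongrightarrow> 0) F"
  unfolding absval_eq_dist by (rule tendsto_dist_iff)

lemma tendsto_absval_0_iff:
  "(f \<longlongrightarrow> (0 :: 'a::nonarch_complete_field)) F \<longleftrightarrow> ((\<lambda>x. absval (f x)) \<longlongrightarrow> 0) F"
  by (simp add: tendsto_absval_iff)

lemma tendsto_absval_null_bound:
  fixes f :: "'b \<Rightarrow> 'a::nonarch_complete_field"
  assumes "\<And>x. absval (f x - a) \<le> g x" and "(g \<longlongrightarrow> 0) F"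
  shows "(f \<longlongrightarrow> a) F"
  unfolding tendsto_absval_iff
  by (rule tendsto_sandwich[OF _ _ tendsto_const assms(2)]) (use assms(1) in auto)

text \<open>The ultrametric inequality makes addition continuous; this instance and the next open
  the generic limit rules for sums and products.\<close>

instance nonarch_complete_field \<subseteq> topological_ab_group_add
proof
  fix a b :: 'a
  show "LIM x (nhds a \<times>\<^sub>F nhds b). fst x + snd x :> nhds (a + b)"
  proof (rule tendsto_absval_null_bound)
    show "absval (fst x + snd x - (a + b)) \<le> max (dist (fst x) a) (dist (snd x) b)"
      for x :: "'a \<times> 'a"
      using absval_add[of "fst x - a" "snd x - b"] by (simp add: dist_absval algebra_simps)
    have "((\<lambda>x. max (dist (fst x) a) (dist (snd x) b)) \<longlongrightarrow> max (dist a a) (dist b b))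
            (nhds a \<times>\<^sub>F nhds b)"
      by (intro tendsto_intros filterlim_fst filterlim_snd)
    then show "((\<lambda>x. max (dist (fst x) a) (dist (snd x) b)) \<longlongrightarrow> 0) (nhds a \<times>\<^sub>F nhds b)"
      by simp
  qed
  show "(uminus \<longlongrightarrow> - a) (nhds a)"
  proof (rule tendsto_absval_null_bound)
    show "absval (- x - - a) \<le> dist x a" for x
      using absval_minus_commute[of a x] by (simp add: dist_absval)
    show "((\<lambda>x. dist x a) \<longlongrightarrow> 0) (nhds a)"
      using tendsto_dist[OF filterlim_ident[of "nhds a"] tendsto_const[of a]] by simp
  qed
qed

instance nonarch_complete_field \<subseteq> topological_semigroup_mult
proof
  fix a b :: 'a
  show "LIM x (nhds a \<times>\<^sub>F nhds b). fst x * snd x :> nhds (a * b)"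
  proof (rule tendsto_absval_null_bound)
    show "absval (fst x * snd x - a * b)
            \<le> max (dist (fst x) a * dist (snd x) 0) (dist a 0 * dist (snd x) b)"
      for x :: "'a \<times> 'a"
      using absval_add[of "(fst x - a) * snd x" "a * (snd x - b)"]
      by (simp add: dist_absval absval_mult) (simp add: algebra_simps)
    have "((\<lambda>x. max (dist (fst x) a * dist (snd x) 0) (dist a 0 * dist (snd x) b))
            \<longlongrightarrow> max (dist a a * dist b 0) (dist a 0 * dist b b)) (nhds a \<times>\<^sub>F nhds b)"
      by (intro tendsto_intros filterlim_fst filterlim_snd)
    then show "((\<lambda>x. max (dist (fst x) a * dist (snd x) 0) (dist a 0 * dist (snd x) b)) \<longlongrightarrow> 0)
        (nhds a \<times>\<^sub>F nhds b)"
      by simp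
  qed
qed

lemma tendsto_absval:
  fixes f :: "'b \<Rightarrow> 'a::nonarch_complete_field"
  shows "(f \<longlongrightarrow> a) F \<Longrightarrow> ((\<lambda>x. absval (f x)) \<longlongrightarrow> absval a) F"
  unfolding absval_dist_0 by (intro tendsto_intros)

text \<open>The difference of the inverses is \<open>(a - f x) / (f x * a)\<close>. Its absolute
  value is a real quotient whose denominator tends to \<open>absval a * absval a\<close>, which is
  nonzero.\<close>

lemma tendsto_inverse_nonarch:
  fixes f :: "'b \<Rightarrow> 'a::nonarch_complete_field"
  assumes f: "(f \<longlongrightarrow> a) F" and a: "a \<noteq> 0"
  shows "((\<lambda>x. inverse (f x)) \<longlongrightarrow> inverse a) F"
proof -
  have ne: "\<forall>\<^sub>F x in F. f x \<noteq> 0"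
    by (rule tendsto_imp_eventually_ne[OF f a])
  have "((\<lambda>x. absval (f x - a) / (absval (f x) * absval a))
          \<longlongrightarrow> absval (a - a) / (absval a * absval a)) F"
    by (intro tendsto_intros tendsto_absval f) (use a in auto)
  then have "((\<lambda>x. absval (f x - a) / (absval (f x) * absval a)) \<longlongrightarrow> 0) F"
    by simp
  moreover have "\<forall>\<^sub>F x in F. absval (f x - a) / (absval (f x) * absval a)
                    = absval (inverse (f x) - inverse a)"
    using ne
  proof eventually_elim
    case (elim x)
    have "inverse (f x) - inverse a = (a - f x) / (f x * a)"
      using elim a by (simp add: field_simps)
    then show ?case
      using absval_minus_commute[of a "f x"] by (simp add: absval_divide absval_mult)
  qed
  ultimately show ?thesis
    unfolding tendsto_absval_iff[of "\<lambda>x. inverse (f x)"] by (rule Lim_transform_eventually)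
qed

section \<open>Ultrametric series\<close>

lemma absval_LIMSEQ_le:
  fixes X :: "nat \<Rightarrow> 'a::nonarch_complete_field"
  assumes "X \<longlonglongrightarrow> a" and "\<And>n. absval (X n) \<le> B"
  shows "absval a \<le> B"
  by (rule Lim_bounded[OF tendsto_absval[OF assms(1)]]) (use assms(2) in auto)

lemma absval_sums_le:
  fixes f :: "nat \<Rightarrow> 'a::nonarch_complete_field"
  assumes "f sums s" and "\<And>n. absval (f n) \<le> B"
  shows "absval s \<le> B"
proof (rule absval_LIMSEQ_le)
  show "(\<lambda>n. sum f {..<n}) \<longlonglongrightarrow> s"
    using assms(1) by (simp add: sums_def)
  show "absval (sum f {..<n}) \<le> B" for n
    using assms(2) order_trans[OF absval_nonneg assms(2)] by (intro absval_sum_le) auto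
qed

lemma sums_tail_nonarch:
  fixes f :: "nat \<Rightarrow> 'a::nonarch_complete_field"
  assumes "f sums s"
  shows "(\<lambda>n. f (Suc n)) sums (s - f 0)"
proof -
  have "(\<lambda>n. sum f {..<Suc n} - f 0) \<longlonglongrightarrow> s - f 0"
    using assms unfolding sums_def by (intro tendsto_intros LIMSEQ_Suc)
  then show ?thesis
    unfolding sums_def sum.lessThan_Suc_shift by simp
qed

text \<open>A block of terms is no larger than its largest term, so null terms alone make the
  partial sums Cauchy.\<close>

lemma summable_nonarch:
  fixes f :: "nat \<Rightarrow> 'a::nonarch_complete_field"
  assumes "f \<longlonglongrightarrow> 0"
  shows "summable f"
proof -
  have "Cauchy (\<lambda>n. sum f {..<n})"
  proof (rule metric_CauchyI)
    fix e :: real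
    assume e: "0 < e"
    then obtain N where N: "\<And>n. n \<ge> N \<Longrightarrow> absval (f n) < e / 2"
      using metric_LIMSEQ_D[OF assms, of "e / 2"] by (auto simp: absval_dist_0)
    have *: "dist (sum f {..<m}) (sum f {..<n}) < e" if "N \<le> n" "n \<le> m" for m n
    proof -
      have "sum f {..<m} - sum f {..<n} = sum f ({..<m} - {..<n})"
        using that by (subst sum_diff) auto
      moreover have "absval (sum f ({..<m} - {..<n})) \<le> e / 2"
        using that e by (intro absval_sum_le less_imp_le[OF N]) auto
      ultimately show ?thesis
        using e by (simp add: dist_absval)
    qed
    have "dist (sum f {..<m}) (sum f {..<n}) < e" if "N \<le> n" "N \<le> m" for m n
      using that *[of n m] *[of m n] by (cases "n \<le> m") (auto simp: dist_commute)
    then show "\<exists>M. \<forall>m\<ge>M. \<forall>n\<ge>M. dist (sum f {..<m}) (sum f {..<n}) < e"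
      by auto
  qed
  then show ?thesis
    by (simp add: summable_iff_convergent Cauchy_convergent_iff)
qed

lemma summable_geometric_bound:
  fixes f :: "nat \<Rightarrow> 'a::nonarch_complete_field"
  assumes "\<And>n. absval (f n) \<le> C * \<rho> ^ n" and "0 \<le> \<rho>" "\<rho> < 1"
  shows "summable f"
proof (rule summable_nonarch, rule tendsto_absval_null_bound)
  show "absval (f n - 0) \<le> C * \<rho> ^ n" for n
    using assms(1) by simp
  show "(\<lambda>n. C * \<rho> ^ n) \<longlonglongrightarrow> 0"
    by (rule tendsto_mult_right_zero) (use assms in \<open>auto intro: LIMSEQ_power_zero\<close>)
qed

text \<open>The product of the \<open>N\<close>-th partial sums exceeds the triangular sum by the
  terms with \<open>i, j < N\<close> and \<open>i + j \<ge> N\<close>. Each has size at most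
  \<open>\<rho> ^ N\<close>, hence so has their sum.\<close>

lemma Cauchy_product_sums_nonarch:
  fixes f g :: "nat \<Rightarrow> 'a::nonarch_complete_field"
  assumes f: "\<And>n. absval (f n) \<le> \<rho> ^ n" and g: "\<And>n. absval (g n) \<le> \<rho> ^ n"
    and \<rho>: "0 \<le> \<rho>" "\<rho> < 1" and A: "f sums A" and B: "g sums B"
  shows "(\<lambda>n. \<Sum>i\<le>n. f i * g (n - i)) sums (A * B)"
proof -
  have tri: "(\<Sum>n<N. \<Sum>i\<le>n. f i * g (n - i)) = (\<Sum>(i, j)\<in>{(i, j). i + j < N}. f i * g j)" for N
    by (rule sum.triangle_reindex[symmetric])
  have sq: "sum f {..<N} * sum g {..<N} = (\<Sum>(i, j)\<in>{..<N} \<times> {..<N}. f i * g j)" for N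
    by (simp add: sum_product sum.cartesian_product)
  have d: "(\<lambda>N. (\<Sum>n<N. \<Sum>i\<le>n. f i * g (n - i)) - sum f {..<N} * sum g {..<N}) \<longlonglongrightarrow> 0"
  proof (rule tendsto_absval_null_bound)
    fix N :: nat
    let ?D = "{..<N} \<times> {..<N} - {(i, j). i + j < N}"
    have "sum f {..<N} * sum g {..<N} - (\<Sum>n<N. \<Sum>i\<le>n. f i * g (n - i))
            = (\<Sum>(i, j)\<in>?D. f i * g j)"
      unfolding tri sq by (subst sum_diff) auto
    moreover have "absval (\<Sum>(i, j)\<in>?D. f i * g j) \<le> \<rho> ^ N"
    proof (rule absval_sum_le)
      fix z assume z: "z \<in> ?D"
      obtain i j where ij: "z = (i, j)"
        by force
      have "absval (f i * g j) \<le> \<rho> ^ i * \<rho> ^ j"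
        unfolding absval_mult by (intro mult_mono f g) (use \<rho> in auto)
      also have "\<dots> \<le> \<rho> ^ N"
        using z \<rho> unfolding ij power_add[symmetric] by (intro power_decreasing) auto
      finally show "absval (case z of (i, j) \<Rightarrow> f i * g j) \<le> \<rho> ^ N"
        by (simp add: ij)
    qed (use \<rho> in auto)
    ultimately show "absval ((\<Sum>n<N. \<Sum>i\<le>n. f i * g (n - i)) - sum f {..<N} * sum g {..<N} - 0) \<le> \<rho> ^ N"
      by (simp only: diff_zero absval_minus_commute[of _ "sum f {..<N} * sum g {..<N}"])
  qed (use \<rho> in \<open>auto intro: LIMSEQ_power_zero\<close>)
  have s: "(\<lambda>N. sum f {..<N} * sum g {..<N}) \<longlonglongrightarrow> A * B"
    using A B unfolding sums_def by (rule tendsto_mult)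
  show ?thesis
    unfolding sums_def using tendsto_add[OF d s] by simp
qed

section \<open>The \<open>p\<close>-adic exponential and logarithm\<close>

locale padic_field =
  fixes p :: nat and T :: "'a::nonarch_complete_field itself"
  assumes prime_p: "prime p" and absval_p: "absval (of_nat p :: 'a) = 1 / real p"
begin

text \<open>The radius of convergence of the \<open>p\<close>-adic exponential series.\<close>

definition rad :: real where
  "rad = real p powr (- 1 / (real p - 1))"

lemma p_gt_1: "1 < p"
  using prime_p prime_gt_1_nat by blast

lemma rad_pos: "0 < rad"
  using p_gt_1 by (simp add: rad_def)

lemma rad_lt_1: "rad < 1"
  unfolding rad_def using p_gt_1 by (intro powr_less_one) auto

lemma rad_power: "rad ^ (p - 1) = 1 / real p"
proof -
  have "rad ^ (p - 1) = rad powr real (p - 1)"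
    using rad_pos by (simp add: powr_realpow)
  also have "\<dots> = real p powr (- 1)"
    unfolding rad_def powr_powr using p_gt_1 by (simp add: of_nat_diff)
  finally show ?thesis
    using p_gt_1 by (simp add: powr_minus inverse_eq_divide)
qed

section \<open>Absolute values of integers and factorials\<close>

lemma absval_of_nat_coprime:
  assumes "\<not> p dvd n"
  shows "absval (of_nat n :: 'a) = 1"
proof -
  have "coprime (int n) (int p)"
    using prime_imp_coprime[OF prime_p assms] by (simp add: coprime_commute)
  then obtain a b where ab: "a * int n + b * int p = 1"
    using coprime_iff_gcd_eq_1 bezout_int by metis
  have "1 = of_int a * of_nat n + of_int b * (of_nat p :: 'a)"
    using arg_cong[OF ab, of "of_int :: int \<Rightarrow> 'a"] by simp
  \<comment> \<open>The multiple of \<open>p\<close> in the Bezout relation has absolute value below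
    1, so the maximum must be reached by the multiple of \<open>n\<close>.\<close>
  then have "1 \<le> max (absval (of_int a * of_nat n :: 'a)) (absval (of_int b * of_nat p :: 'a))"
    by (metis absval_1 absval_add)
  moreover have "absval (of_int b * of_nat p :: 'a) < 1"
  proof -
    have "absval (of_int b * of_nat p :: 'a) \<le> 1 * (1 / real p)"
      unfolding absval_mult absval_p by (intro mult_right_mono absval_of_int_le_1) simp
    also have "\<dots> < 1"
      using p_gt_1 by simp
    finally show ?thesis .
  qed
  moreover have "absval (of_int a * of_nat n :: 'a) \<le> 1 * absval (of_nat n :: 'a)"
    unfolding absval_mult by (intro mult_right_mono absval_of_int_le_1) simp
  ultimately have "1 \<le> absval (of_nat n :: 'a)"
    by linarith
  then show ?thesis
    using absval_of_nat_le_1[of n, where 'a = 'a] by linarith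
qed

text \<open>A crude form of \<open>|n| = p^(-v)\<close> with \<open>p^v \<le> n\<close>; the
  induction strips off one factor \<open>p\<close> at a time.\<close>

lemma absval_of_nat_ge: "0 < n \<Longrightarrow> 1 / real n \<le> absval (of_nat n :: 'a)"
proof (induction n rule: less_induct)
  case (less n)
  show ?case
  proof (cases "p dvd n")
    case False
    then show ?thesis
      using less.prems by (simp add: absval_of_nat_coprime)
  next
    case True
    then obtain m where m: "n = p * m"
      by blast
    with less.prems p_gt_1 have "0 < m" "m < n"
      by auto
    with less.IH have "1 / real p * (1 / real m) \<le> 1 / real p * absval (of_nat m :: 'a)"
      by (intro mult_left_mono) auto
    then show ?thesis
      by (simp add: m absval_mult absval_p)
  qed
qed

text \<open>Among the factors of \<open>n!\<close> only the multiples of \<open>p\<close> are not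
  units, and their product is \<open>p^(n div p)\<close> times \<open>(n div p)!\<close>.\<close>

lemma absval_fact_div: "absval (fact n :: 'a) = (1 / real p) ^ (n div p) * absval (fact (n div p) :: 'a)"
proof (induction n)
  case (Suc n)
  show ?case
  proof (cases "p dvd Suc n")
    case True
    then have d: "Suc n div p = Suc (n div p)"
      by (simp add: div_Suc dvd_eq_mod_eq_0)
    have "Suc n = p * Suc (n div p)"
      using True d by (metis dvd_mult_div_cancel)
    then have "(of_nat (Suc n) :: 'a) = of_nat p * of_nat (Suc (n div p))"
      by (metis of_nat_mult)
    then have "absval (of_nat (Suc n) :: 'a) = 1 / real p * absval (of_nat (Suc (n div p)) :: 'a)"
      by (simp add: absval_mult absval_p del: of_nat_Suc)
    then show ?thesis
      by (simp add: d Suc absval_mult del: of_nat_Suc)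
  next
    case False
    then have "Suc n div p = n div p"
      by (simp add: div_Suc dvd_eq_mod_eq_0)
    then show ?thesis
      using absval_of_nat_coprime[OF False] by (simp add: Suc absval_mult del: of_nat_Suc)
  qed
qed simp

text \<open>Legendre's bound \<open>v\<^sub>p(n!) \<le> (n - 1)/(p - 1)\<close>; truncated subtraction covers \<open>n = 0\<close>.\<close>
lemma absval_fact_ge: "rad ^ (n - 1) \<le> absval (fact n :: 'a)"
proof (induction n rule: less_induct)
  case (less n)
  define m where "m = n div p"
  show ?case
  proof (cases "m = 0")
    case True
    then have "absval (fact n :: 'a) = 1"
      unfolding absval_fact_div[of n] m_def by simp
    then show ?thesis
      using rad_pos rad_lt_1 by (simp add: power_le_one)
  next
    case False
    then have "m < n"
      using p_gt_1 unfolding m_def by (metis div_0 div_less_dividend not_gr_zero)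
    have "p * m \<le> n"
      unfolding m_def by simp
    moreover have "p * m = (p - 1) * m + m"
      using p_gt_1 by (cases p) auto
    \<comment> \<open>As \<open>m\<close> is positive, the left side is \<open>p * m - 1\<close>.
      The split lets \<open>rad ^ (p - 1) = 1 / p\<close> be used \<open>m\<close> times and leaves
      the exponent of the induction hypothesis.\<close>
    ultimately have "(p - 1) * m + (m - 1) \<le> n - 1"
      using False by linarith
    then have "rad ^ (n - 1) \<le> rad ^ ((p - 1) * m + (m - 1))"
      using rad_pos rad_lt_1 by (intro power_decreasing) auto
    also have "\<dots> = (1 / real p) ^ m * rad ^ (m - 1)"
      by (simp only: power_add power_mult rad_power)
    also have "\<dots> \<le> (1 / real p) ^ m * absval (fact m :: 'a)"
      using less.IH[OF \<open>m < n\<close>] by (intro mult_left_mono) auto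
    also have "\<dots> = absval (fact n :: 'a)"
      unfolding absval_fact_div[of n] m_def ..
    finally show ?thesis .
  qed
qed

text \<open>Since \<open>n + 1\<close> divides \<open>(n + 1)!\<close>, the factorial bound carries
  over, and one radius serves both the exponential and the logarithm series.\<close>

lemma absval_of_nat_Suc_ge: "rad ^ n \<le> absval (of_nat (Suc n) :: 'a)"
proof -
  have "rad ^ n \<le> absval (fact (Suc n) :: 'a)"
    using absval_fact_ge[of "Suc n"] by simp
  also have "\<dots> = absval (of_nat (Suc n) :: 'a) * absval (of_nat (fact n) :: 'a)"
    by (simp add: absval_mult del: of_nat_Suc)
  also have "\<dots> \<le> absval (of_nat (Suc n) :: 'a) * 1"
    by (intro mult_left_mono absval_of_nat_le_1) auto
  finally show ?thesis
    by simp
qed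

section \<open>The exponential series\<close>

lemma absval_exp_term: "absval (z ^ Suc n / fact (Suc n) :: 'a) \<le> absval z * (absval z / rad) ^ n"
proof -
  have "absval (z ^ Suc n / fact (Suc n) :: 'a) = absval z ^ Suc n / absval (fact (Suc n) :: 'a)"
    by (simp add: absval_divide absval_power absval_mult)
  \<comment> \<open>Legendre's bound at \<open>Suc n\<close> has exponent \<open>n\<close>, so one
    factor \<open>absval z\<close> remains outside the geometric ratio; the first- and second-order
    estimates below rely on it.\<close>
  also have "\<dots> \<le> absval z ^ Suc n / rad ^ n"
    using absval_fact_ge[of "Suc n"] rad_pos
    by (intro divide_left_mono mult_pos_pos) (auto simp del: fact_Suc)
  finally show ?thesis
    by (simp add: power_divide)
qed

text \<open>The shape that \<open>Cauchy_product_sums_nonarch\<close> expects: no constant in front,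
  and \<open>n = 0\<close> included.\<close>

lemma absval_exp_term_le_power:
  assumes "absval (z :: 'a) \<le> rad * \<rho>"
  shows "absval (z ^ n / fact n :: 'a) \<le> \<rho> ^ n"
proof (cases n)
  case (Suc m)
  have "0 \<le> rad * \<rho>"
    using assms absval_nonneg order_trans by blast
  then have "0 \<le> \<rho>"
    using rad_pos by (simp add: zero_le_mult_iff)
  have "absval z \<le> \<rho>"
    using assms rad_lt_1 rad_pos \<open>0 \<le> \<rho>\<close> by (meson less_imp_le mult_left_le_one_le order_trans)
  have "absval (z ^ Suc m / fact (Suc m)) \<le> absval z * (absval z / rad) ^ m"
    by (rule absval_exp_term)
  also have "\<dots> \<le> \<rho> * \<rho> ^ m"
    using assms rad_pos \<open>absval z \<le> \<rho>\<close> \<open>0 \<le> \<rho>\<close>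
    by (intro mult_mono power_mono) (auto simp: field_simps)
  finally show ?thesis
    by (simp add: Suc)
qed simp

lemma Cp_exp_sums:
  assumes "absval (z :: 'a) < rad"
  shows "(\<lambda>n. z ^ n / fact n) sums Cp_exp z"
  unfolding Cp_exp_def
proof (rule summable_sums, rule summable_geometric_bound)
  show "absval (z ^ n / fact n) \<le> 1 * (absval z / rad) ^ n" for n
    using absval_exp_term_le_power[of z "absval z / rad" n] rad_pos by simp
qed (use assms rad_pos in auto)

lemma Cp_exp_0 [simp]: "Cp_exp (0 :: 'a) = 1"
proof -
  have "(\<lambda>n. (0::'a) ^ n / fact n) sums (\<Sum>n\<in>{0}. 0 ^ n / fact n)"
    by (rule sums_finite) auto
  then show ?thesis
    unfolding Cp_exp_def by (simp add: sums_iff)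
qed

lemma Cp_exp_add:
  assumes "absval (a :: 'a) < rad" "absval b < rad"
  shows "Cp_exp (a + b) = Cp_exp a * Cp_exp b"
proof -
  define \<rho> where "\<rho> = max (absval a) (absval b) / rad"
  have \<rho>: "0 \<le> \<rho>" "\<rho> < 1" "absval a \<le> rad * \<rho>" "absval b \<le> rad * \<rho>"
    using assms rad_pos by (auto simp: \<rho>_def le_max_iff_disj)
  have ab: "absval (a + b) < rad"
    using absval_add[of a b] assms by linarith
  have "(\<lambda>n. \<Sum>i\<le>n. (a ^ i / fact i) * (b ^ (n - i) / fact (n - i))) sums (Cp_exp a * Cp_exp b)"
    using \<rho> assms by (intro Cauchy_product_sums_nonarch[of _ \<rho>] absval_exp_term_le_power Cp_exp_sums)
  moreover have "(\<Sum>i\<le>n. (a ^ i / fact i) * (b ^ (n - i) / fact (n - i))) = (a + b) ^ n / fact n" for n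
  proof -
    have "(a + b) ^ n / fact n = (\<Sum>i\<le>n. of_nat (n choose i) * a ^ i * b ^ (n - i) / fact n)"
      by (simp add: binomial_ring sum_divide_distrib)
    also have "\<dots> = (\<Sum>i\<le>n. (a ^ i / fact i) * (b ^ (n - i) / fact (n - i)))"
      by (intro sum.cong refl) (simp add: binomial_fact field_simps)
    finally show ?thesis ..
  qed
  ultimately have "(\<lambda>n. (a + b) ^ n / fact n) sums (Cp_exp a * Cp_exp b)"
    by simp
  with Cp_exp_sums[OF ab] show ?thesis
    using sums_unique2 by blast
qed

lemma absval_Cp_exp_minus_1:
  assumes "absval (z :: 'a) < rad"
  shows "absval (Cp_exp z - 1) \<le> absval z"
proof (rule absval_sums_le)
  show "(\<lambda>n. z ^ Suc n / fact (Suc n)) sums (Cp_exp z - 1)"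
    using sums_tail_nonarch[OF Cp_exp_sums[OF assms]] by simp
  show "absval (z ^ Suc n / fact (Suc n)) \<le> absval z" for n
  proof (rule order_trans[OF absval_exp_term])
    show "absval z * (absval z / rad) ^ n \<le> absval z"
      using assms rad_pos by (intro mult_right_le_one_le power_le_one) auto
  qed
qed

text \<open>The error must be quadratic: in \<open>Cp_log_exp\<close> the argument is scaled by
  \<open>p ^ N\<close>, the error is divided by \<open>p ^ N\<close>, and the result still has to
  tend to 0.\<close>

lemma absval_Cp_exp_minus_linear:
  assumes "absval (z :: 'a) < rad"
  shows "absval (Cp_exp z - 1 - z) \<le> absval z ^ 2 / rad"
proof (rule absval_sums_le)
  show "(\<lambda>n. z ^ Suc (Suc n) / fact (Suc (Suc n))) sums (Cp_exp z - 1 - z)"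
    using sums_tail_nonarch[OF sums_tail_nonarch[OF Cp_exp_sums[OF assms]]] by simp
  show "absval (z ^ Suc (Suc n) / fact (Suc (Suc n))) \<le> absval z ^ 2 / rad" for n
  proof (rule order_trans[OF absval_exp_term])
    have "absval z * (absval z / rad) ^ Suc n \<le> absval z * (absval z / rad) ^ 1"
      using assms rad_pos by (intro mult_left_mono power_decreasing) auto
    then show "absval z * (absval z / rad) ^ Suc n \<le> absval z ^ 2 / rad"
      by (simp add: power2_eq_square)
  qed
qed

lemma absval_of_int_mult_less:
  assumes "absval (z :: 'a) < rad"
  shows "absval (of_int n * z) < rad"
  using mult_right_mono[OF absval_of_int_le_1[of n, where 'a = 'a] absval_nonneg[of z]] assms
  by (simp add: absval_mult)

lemma absval_of_nat_mult_less:
  assumes "absval (z :: 'a) < rad"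
  shows "absval (of_nat n * z) < rad"
  using absval_of_int_mult_less[OF assms, of "int n"] by simp

lemma Cp_exp_of_nat_mult:
  assumes "absval (z :: 'a) < rad"
  shows "Cp_exp (of_nat n * z) = Cp_exp z ^ n"
proof (induction n)
  case (Suc n)
  have "Cp_exp (z + of_nat n * z) = Cp_exp z * Cp_exp (of_nat n * z)"
    by (intro Cp_exp_add assms absval_of_nat_mult_less)
  then show ?case
    by (simp add: Suc distrib_right)
qed simp

lemma Cp_exp_of_int_mult:
  assumes "absval (z :: 'a) < rad"
  shows "Cp_exp (of_int n * z) = Cp_exp z powi n"
proof (cases n rule: int_cases2)
  case (nonneg m)
  then show ?thesis
    using Cp_exp_of_nat_mult[OF assms] by simp
next
  case (nonpos m)
  have "Cp_exp (of_nat m * z + - (of_nat m * z)) = Cp_exp (of_nat m * z) * Cp_exp (- (of_nat m * z))"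
    using absval_of_nat_mult_less[OF assms, of m] by (intro Cp_exp_add) simp_all
  then have "Cp_exp z ^ m * Cp_exp (- (of_nat m * z)) = 1"
    by (simp add: Cp_exp_of_nat_mult[OF assms])
  then have "Cp_exp (- (of_nat m * z)) = inverse (Cp_exp z ^ m)"
    using inverse_unique by metis
  then show ?thesis
    by (simp add: nonpos power_int_minus)
qed

section \<open>The logarithm series\<close>

lemma absval_log_term:
  "absval ((- 1) ^ n * u ^ Suc n / of_nat (Suc n) :: 'a) \<le> absval u * (absval u / rad) ^ n"
proof -
  have "absval ((- 1) ^ n * u ^ Suc n / of_nat (Suc n) :: 'a)
          = absval u ^ Suc n / absval (of_nat (Suc n) :: 'a)"
    by (simp add: absval_divide absval_power absval_mult del: of_nat_Suc)
  also have "\<dots> \<le> absval u ^ Suc n / rad ^ n"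
    using absval_of_nat_Suc_ge[of n] rad_pos
    by (intro divide_left_mono mult_pos_pos) (auto simp del: of_nat_Suc)
  finally show ?thesis
    by (simp add: power_divide)
qed

lemma Cp_log_sums:
  assumes "absval (u - 1 :: 'a) < rad"
  shows "(\<lambda>n. (- 1) ^ n * (u - 1) ^ Suc n / of_nat (Suc n)) sums Cp_log u"
  unfolding Cp_log_def
  by (rule summable_sums, rule summable_geometric_bound, rule absval_log_term)
    (use assms rad_pos in auto)

text \<open>Inside the disc the linear term dominates. This keeps the logarithm within the domain of
  the exponential and makes its kernel trivial.\<close>

lemma absval_Cp_log_minus_linear:
  assumes "absval (u - 1 :: 'a) < rad"
  shows "absval (Cp_log u - (u - 1)) \<le> absval (u - 1) * (absval (u - 1) / rad)"
proof (rule absval_sums_le)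
  show "(\<lambda>n. (- 1) ^ Suc n * (u - 1) ^ Suc (Suc n) / of_nat (Suc (Suc n))) sums (Cp_log u - (u - 1))"
    using sums_tail_nonarch[OF Cp_log_sums[OF assms]] by simp
  show "absval ((- 1) ^ Suc n * (u - 1) ^ Suc (Suc n) / of_nat (Suc (Suc n)))
          \<le> absval (u - 1) * (absval (u - 1) / rad)" for n
  proof (rule order_trans[OF absval_log_term])
    have "(absval (u - 1) / rad) ^ Suc n \<le> (absval (u - 1) / rad) ^ 1"
      using assms rad_pos by (intro power_decreasing) auto
    then show "absval (u - 1) * (absval (u - 1) / rad) ^ Suc n
          \<le> absval (u - 1) * (absval (u - 1) / rad)"
      by (intro mult_left_mono) auto
  qed
qed

lemma absval_Cp_log_less:
  assumes "absval (u - 1 :: 'a) < rad"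
  shows "absval (Cp_log u) < rad"
proof -
  have "absval (u - 1) * (absval (u - 1) / rad) \<le> absval (u - 1)"
    using assms rad_pos by (intro mult_right_le_one_le) auto
  then show ?thesis
    using absval_add[of "Cp_log u - (u - 1)" "u - 1"] absval_Cp_log_minus_linear[OF assms] assms
    by simp
qed

text \<open>If the logarithm vanishes, the linear estimate bounds \<open>absval (u - 1)\<close> by
  itself times a factor below 1.\<close>

lemma Cp_log_eq_0_imp:
  assumes "absval (u - 1 :: 'a) < rad" and "Cp_log u = 0"
  shows "u = 1"
proof (rule ccontr)
  assume "u \<noteq> 1"
  have "absval (u - 1) \<le> absval (u - 1) * (absval (u - 1) / rad)"
    using absval_Cp_log_minus_linear[OF assms(1)] absval_minus_commute[of 1 u] assms(2) by simp
  also have "\<dots> < absval (u - 1) * 1"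
    using assms(1) rad_pos \<open>u \<noteq> 1\<close> by (intro mult_strict_left_mono) auto
  finally show False
    by simp
qed

section \<open>The logarithm as a limit of quotients \<open>(u^P - 1)/P\<close>\<close>

lemma absval_p_power: "absval (of_nat (p ^ N) :: 'a) = (1 / real p) ^ N"
  by (simp add: absval_power absval_p)

lemma p_power_tendsto_0: "(\<lambda>N. absval (of_nat (p ^ N) :: 'a)) \<longlonglongrightarrow> 0"
  unfolding absval_p_power using p_gt_1 by (intro LIMSEQ_power_zero) auto

text \<open>A congruence modulo \<open>n + 1\<close>, to be used with \<open>n + 1 = p ^ N\<close>.
  In the induction, Pascal's rule brings in \<open>Suc n choose Suc k\<close>, which is
  \<open>n + 1\<close> times an integer over \<open>k + 1\<close>; this denominator costs at most a
  factor \<open>k + 1\<close>.\<close>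

lemma absval_binomial_minus_sign:
  "absval (of_nat (n choose k) - (- 1) ^ k :: 'a) \<le> absval (of_nat (Suc n) :: 'a) * real k"
proof (induction k)
  case (Suc k)
  let ?P = "absval (of_nat (Suc n) :: 'a)"
  have "(of_nat (Suc n choose Suc k) :: 'a) * of_nat (Suc k) = of_nat (Suc n) * of_nat (n choose k)"
    unfolding of_nat_mult[symmetric] Suc_times_binomial_eq ..
  then have "(of_nat (Suc n choose Suc k) :: 'a) = of_nat (Suc n) * of_nat (n choose k) / of_nat (Suc k)"
    using of_nat_neq_0[of k, where 'a = 'a] by (simp add: field_simps del: of_nat_Suc)
  then have "absval (of_nat (Suc n choose Suc k) :: 'a)
      = ?P * absval (of_nat (n choose k) :: 'a) / absval (of_nat (Suc k) :: 'a)"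
    by (simp add: absval_divide absval_mult del: of_nat_Suc)
  also have "\<dots> \<le> ?P * 1 / (1 / real (Suc k))"
    by (intro frac_le mult_left_mono mult_nonneg_nonneg absval_of_nat_le_1 absval_of_nat_ge) auto
  finally have 1: "absval (of_nat (Suc n choose Suc k) :: 'a) \<le> ?P * real (Suc k)"
    by (simp del: of_nat_Suc)
  have 2: "absval (of_nat (n choose k) - (- 1) ^ k :: 'a) \<le> ?P * real (Suc k)"
    using Suc.IH by (rule order_trans) (intro mult_left_mono, auto)
  have "of_nat (n choose Suc k) - (- 1) ^ Suc k
          = (of_nat (Suc n choose Suc k) - (of_nat (n choose k) - (- 1) ^ k) :: 'a)"
    by simp
  then show ?case
    using absval_diff[of "of_nat (Suc n choose Suc k) :: 'a" "of_nat (n choose k) - (- 1) ^ k"] 1 2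
    by (simp only:)
qed simp

text \<open>Absorption replaces \<open>(n + 1 choose k + 1)/(n + 1)\<close> by
  \<open>(n choose k)/(k + 1)\<close>, so the expansion can be compared term by term with the
  logarithm series.\<close>

lemma power_minus_1_divide_eq:
  "((1 + u) ^ Suc n - 1) / of_nat (Suc n)
     = (\<Sum>k<Suc n. of_nat (n choose k) * u ^ Suc k / (of_nat (Suc k) :: 'a))"
proof -
  have "(1 + u) ^ Suc n = (\<Sum>k\<le>Suc n. of_nat (Suc n choose k) * u ^ k)"
    using binomial_ring[of u 1 "Suc n"] by (simp add: add.commute)
  also have "\<dots> = 1 + (\<Sum>k<Suc n. of_nat (Suc n choose Suc k) * u ^ Suc k)"
    by (simp only: lessThan_Suc_atMost[symmetric] sum.lessThan_Suc_shift) simp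
  finally have "((1 + u) ^ Suc n - 1) / of_nat (Suc n)
      = (\<Sum>k<Suc n. of_nat (Suc n choose Suc k) * u ^ Suc k / of_nat (Suc n))"
    by (simp only: add_diff_cancel_left' sum_divide_distrib)
  also have "\<dots> = (\<Sum>k<Suc n. of_nat (n choose k) * u ^ Suc k / of_nat (Suc k))"
  proof (intro sum.cong refl)
    fix k
    have "(of_nat (Suc n choose Suc k) :: 'a) * of_nat (Suc k) = of_nat (Suc n) * of_nat (n choose k)"
      unfolding of_nat_mult[symmetric] Suc_times_binomial_eq ..
    then have "of_nat (Suc n choose Suc k) / (of_nat (Suc n) :: 'a) = of_nat (n choose k) / of_nat (Suc k)"
      using of_nat_neq_0[of k, where 'a = 'a] of_nat_neq_0[of n, where 'a = 'a]
      by (simp add: frac_eq_eq mult.commute del: of_nat_Suc)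
    then show "of_nat (Suc n choose Suc k) * u ^ Suc k / (of_nat (Suc n) :: 'a)
        = of_nat (n choose k) * u ^ Suc k / of_nat (Suc k)"
      by (metis times_divide_eq_left)
  qed
  finally show ?thesis .
qed

lemma Cp_log_LIMSEQ:
  assumes "absval (u - 1 :: 'a) < rad"
  shows "(\<lambda>N. (u ^ (p ^ N) - 1) / of_nat (p ^ N)) \<longlonglongrightarrow> Cp_log u"
proof -
  define v where "v = u - 1"
  define \<rho> where "\<rho> = absval v / rad"
  have \<rho>: "0 \<le> \<rho>" "\<rho> < 1" and v: "absval v \<le> 1"
    using assms rad_pos rad_lt_1 by (auto simp: \<rho>_def v_def)
  have "(\<lambda>k. real k * \<rho> ^ k) \<longlonglongrightarrow> 0"
    using powser_times_n_limit_0[of \<rho>] \<rho> by simp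
  \<comment> \<open>\<open>C\<close> absorbs the factor \<open>k\<close> that
    \<open>absval_binomial_minus_sign\<close> introduces, uniformly in \<open>k\<close>.\<close>
  then obtain C where C: "\<And>k. real k * \<rho> ^ k \<le> C" "0 < C"
    using convergent_imp_Bseq[of "\<lambda>k. real k * \<rho> ^ k"] \<rho>
    by (auto simp: convergent_def Bseq_def)
  let ?a = "\<lambda>k. (- 1) ^ k * v ^ Suc k / (of_nat (Suc k) :: 'a)"
  have d: "(\<lambda>N. (u ^ (p ^ N) - 1) / of_nat (p ^ N) - (\<Sum>k<p ^ N. ?a k)) \<longlonglongrightarrow> 0"
  proof (rule tendsto_absval_null_bound)
    fix N
    have "p ^ N \<noteq> 0"
      using p_gt_1 by simp
    then obtain n where n: "p ^ N = Suc n"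
      using not0_implies_Suc by blast
    have "(u ^ (p ^ N) - 1) / of_nat (p ^ N) - (\<Sum>k<p ^ N. ?a k)
        = (\<Sum>k<Suc n. (of_nat (n choose k) - (- 1) ^ k) * (v ^ Suc k / of_nat (Suc k)))"
      using power_minus_1_divide_eq[of v n] unfolding n v_def
      by (simp add: sum_subtractf[symmetric] left_diff_distrib diff_divide_distrib del: of_nat_Suc sum.lessThan_Suc power_Suc)
    moreover have "absval (\<Sum>k<Suc n. (of_nat (n choose k) - (- 1) ^ k) * (v ^ Suc k / of_nat (Suc k)))
        \<le> absval (of_nat (p ^ N) :: 'a) * C"
    proof (rule absval_sum_le)
      fix k
      have "absval (v ^ Suc k / of_nat (Suc k)) = absval (?a k)"
        by (simp add: absval_mult absval_divide absval_power del: of_nat_Suc)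
      also have "\<dots> \<le> absval v * \<rho> ^ k"
        unfolding \<rho>_def by (rule absval_log_term)
      also have "\<dots> \<le> \<rho> ^ k"
        using v \<rho> by (intro mult_left_le_one_le) auto
      finally have "absval ((of_nat (n choose k) - (- 1) ^ k) * (v ^ Suc k / of_nat (Suc k)))
          \<le> (absval (of_nat (Suc n) :: 'a) * real k) * \<rho> ^ k"
        unfolding absval_mult[of "of_nat (n choose k) - (- 1) ^ k"]
        by (intro mult_mono absval_binomial_minus_sign) auto
      also have "\<dots> \<le> absval (of_nat (Suc n) :: 'a) * C"
        unfolding mult.assoc by (intro mult_left_mono C) auto
      finally show "absval ((of_nat (n choose k) - (- 1) ^ k) * (v ^ Suc k / of_nat (Suc k)))
          \<le> absval (of_nat (p ^ N) :: 'a) * C"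
        unfolding n .
    qed (use C in auto)
    ultimately show "absval ((u ^ (p ^ N) - 1) / of_nat (p ^ N) - (\<Sum>k<p ^ N. ?a k) - 0)
        \<le> absval (of_nat (p ^ N) :: 'a) * C"
      by (simp only: diff_zero)
  next
    show "(\<lambda>N. absval (of_nat (p ^ N) :: 'a) * C) \<longlonglongrightarrow> 0"
      by (rule tendsto_mult_left_zero[OF p_power_tendsto_0])
  qed
  have "(\<lambda>n. \<Sum>k<n. ?a k) \<longlonglongrightarrow> Cp_log u"
    using Cp_log_sums[OF assms] unfolding sums_def v_def .
  moreover have "filterlim (\<lambda>N. p ^ N) at_top sequentially"
    using p_gt_1 by (intro filterlim_subseq strict_monoI) (simp add: power_strict_increasing)
  ultimately have s: "(\<lambda>N. \<Sum>k<p ^ N. ?a k) \<longlonglongrightarrow> Cp_log u"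
    by (rule filterlim_compose)
  show ?thesis
    using tendsto_add[OF d s] by simp
qed

text \<open>With \<open>P = p ^ N\<close>, write \<open>u^P = P * ((u^P - 1)/P) + 1\<close>: the
  quotient converges and \<open>P\<close> tends to 0.\<close>

lemma power_p_power_LIMSEQ:
  assumes "absval (u - 1 :: 'a) < rad"
  shows "(\<lambda>N. u ^ (p ^ N)) \<longlonglongrightarrow> 1"
proof -
  have "(\<lambda>N. of_nat (p ^ N) :: 'a) \<longlonglongrightarrow> 0"
    using p_power_tendsto_0 by (simp only: tendsto_absval_0_iff)
  then have "(\<lambda>N. of_nat (p ^ N) * ((u ^ (p ^ N) - 1) / of_nat (p ^ N)) + 1) \<longlonglongrightarrow> 0 * Cp_log u + 1"
    by (intro tendsto_intros Cp_log_LIMSEQ assms)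
  then show ?thesis
    using p_gt_1 by simp
qed

section \<open>The disc of radius \<open>rad\<close> around 1 as a multiplicative group\<close>

lemma absval_eq_1_of_disc:
  assumes "absval (u - 1 :: 'a) < rad"
  shows "absval u = 1"
proof (rule antisym)
  show "absval u \<le> 1"
    using absval_add[of "u - 1" 1] assms rad_lt_1 by simp
  show "1 \<le> absval u"
    using absval_diff[of u "u - 1"] assms rad_lt_1 by auto
qed

lemma disc_mult:
  assumes "absval (u - 1 :: 'a) < rad" "absval (v - 1) < rad"
  shows "absval (u * v - 1) < rad"
  using absval_add[of "u * (v - 1)" "u - 1"] assms absval_eq_1_of_disc[OF assms(1)]
  by (simp add: absval_mult) (simp add: algebra_simps)

lemma disc_power:
  assumes "absval (u - 1 :: 'a) < rad"
  shows "absval (u ^ n - 1) < rad"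
  using assms rad_pos by (induction n) (auto intro: disc_mult)

lemma disc_inverse:
  assumes "absval (u - 1 :: 'a) < rad"
  shows "absval (inverse u - 1) < rad"
proof -
  have "u \<noteq> 0"
    using absval_eq_1_of_disc[OF assms] by auto
  then have "inverse u - 1 = (1 - u) / u"
    by (simp add: field_simps)
  then show ?thesis
    using assms absval_eq_1_of_disc[OF assms] absval_minus_commute[of u 1]
    by (simp add: absval_divide)
qed

lemma disc_power_int:
  assumes "absval (u - 1 :: 'a) < rad"
  shows "absval (u powi n - 1) < rad"
  using assms by (cases n rule: int_cases2) (auto simp: power_int_minus intro: disc_power disc_inverse)

section \<open>The logarithm as a homomorphism inverse to the exponential\<close>

lemma Cp_log_mult:
  assumes "absval (u - 1 :: 'a) < rad" "absval (v - 1) < rad"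
  shows "Cp_log (u * v) = Cp_log u + Cp_log v"
proof -
  \<comment> \<open>This uses \<open>(u v)^P - 1 = (u^P - 1) + u^P (v^P - 1)\<close> together with
    \<open>u^P\<close> tending to 1.\<close>
  have "(\<lambda>N. (u ^ (p ^ N) - 1) / of_nat (p ^ N) + u ^ (p ^ N) * ((v ^ (p ^ N) - 1) / of_nat (p ^ N)))
          \<longlonglongrightarrow> Cp_log u + 1 * Cp_log v"
    by (intro tendsto_intros Cp_log_LIMSEQ power_p_power_LIMSEQ assms)
  also have "(\<lambda>N. (u ^ (p ^ N) - 1) / of_nat (p ^ N) + u ^ (p ^ N) * ((v ^ (p ^ N) - 1) / of_nat (p ^ N)))
        = (\<lambda>N. ((u * v) ^ (p ^ N) - 1) / of_nat (p ^ N))"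
    by (simp add: fun_eq_iff power_mult_distrib right_diff_distrib diff_divide_distrib)
  finally show ?thesis
    using LIMSEQ_unique[OF Cp_log_LIMSEQ[OF disc_mult[OF assms]]] by simp
qed

lemma Cp_log_power:
  assumes "absval (u - 1 :: 'a) < rad"
  shows "Cp_log (u ^ n) = of_nat n * Cp_log u"
proof (induction n)
  case 0
  show ?case
    using Cp_log_mult[of 1 1] rad_pos by simp
next
  case (Suc n)
  then show ?case
    using Cp_log_mult[OF assms disc_power[OF assms, of n]] by (simp add: distrib_right)
qed

text \<open>As \<open>exp(z)^P = exp(P z)\<close>, the quotient defining the limit is
  \<open>z\<close> up to an error proportional to \<open>absval P\<close>.\<close>

lemma Cp_log_exp:
  assumes "absval (z :: 'a) < rad"
  shows "Cp_log (Cp_exp z) = z"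
proof -
  have "absval (Cp_exp z - 1) < rad"
    using absval_Cp_exp_minus_1[OF assms] assms by linarith
  moreover have "(\<lambda>N. (Cp_exp z ^ (p ^ N) - 1) / of_nat (p ^ N)) \<longlonglongrightarrow> z"
  proof (rule tendsto_absval_null_bound)
    fix N
    let ?P = "of_nat (p ^ N) :: 'a"
    have P: "?P \<noteq> 0"
      using p_gt_1 by simp
    have "(Cp_exp z ^ (p ^ N) - 1) / ?P - z = (Cp_exp (?P * z) - 1 - ?P * z) / ?P"
      using P unfolding Cp_exp_of_nat_mult[OF assms] by (simp add: diff_divide_distrib)
    also have "absval \<dots> \<le> (absval (?P * z) ^ 2 / rad) / absval ?P"
      unfolding absval_divide
      by (intro divide_right_mono absval_Cp_exp_minus_linear absval_of_nat_mult_less assms) simp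
    also have "\<dots> = absval ?P * (absval z ^ 2 / rad)"
      using P by (simp add: absval_mult power2_eq_square del: of_nat_power)
    finally show "absval ((Cp_exp z ^ (p ^ N) - 1) / ?P - z) \<le> absval ?P * (absval z ^ 2 / rad)" .
  next
    show "(\<lambda>N. absval (of_nat (p ^ N) :: 'a) * (absval z ^ 2 / rad)) \<longlonglongrightarrow> 0"
      by (rule tendsto_mult_left_zero[OF p_power_tendsto_0])
  qed
  ultimately show ?thesis
    using LIMSEQ_unique Cp_log_LIMSEQ by blast
qed

text \<open>The quotient \<open>w\<close> of \<open>Cp_exp (Cp_log u)\<close> by \<open>u\<close>
  lies in the disc and has logarithm 0, so it is 1.\<close>

lemma Cp_exp_log:
  assumes "absval (u - 1 :: 'a) < rad"
  shows "Cp_exp (Cp_log u) = u"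
proof -
  have u: "u \<noteq> 0"
    using absval_eq_1_of_disc[OF assms] by auto
  have L: "absval (Cp_log u) < rad"
    by (rule absval_Cp_log_less[OF assms])
  have E: "absval (Cp_exp (Cp_log u) - 1) < rad"
    using absval_Cp_exp_minus_1[OF L] L by linarith
  define w where "w = inverse u * Cp_exp (Cp_log u)"
  have w: "absval (w - 1) < rad"
    unfolding w_def by (intro disc_mult disc_inverse assms E)
  have "Cp_log (u * w) = Cp_log u + Cp_log w"
    by (rule Cp_log_mult[OF assms w])
  moreover have "u * w = Cp_exp (Cp_log u)"
    using u by (simp add: w_def)
  ultimately have "Cp_log w = 0"
    by (simp add: Cp_log_exp[OF L])
  then have "w = 1"
    by (rule Cp_log_eq_0_imp[OF w])
  then show ?thesis
    using u by (simp add: w_def field_simps)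
qed

end

section \<open>A closed form for the \<open>q\<close>-Euler polynomials\<close>

lemma power_int_sum:
  fixes x :: "'b::field"
  assumes "x \<noteq> 0"
  shows "x powi (\<Sum>i\<in>A. f i) = (\<Prod>i\<in>A. x powi f i)"
  using assms by (induction A rule: infinite_finite_induct) (auto simp: power_int_add)

text \<open>Used twice: with \<open>n = p ^ N\<close> for the sums defining the integral, and with
  \<open>n = l\<close> for the sums over the residues.\<close>

lemma alternating_geometric_sum:
  fixes b :: "'b::field"
  assumes "1 + b \<noteq> 0" and "odd n"
  shows "(\<Sum>i<n. (- b) ^ i) = (1 + b ^ n) / (1 + b)"
proof -
  have "- b \<noteq> 1"
    using assms(1) by (metis add.right_inverse minus_minus)
  then have "(\<Sum>i<n. (- b) ^ i) = ((- b) ^ n - 1) / (- b - 1)"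
    by (rule geometric_sum)
  also have "\<dots> = (- (1 + b ^ n)) / (- (1 + b))"
    unfolding power_minus_odd[OF assms(2)] by (simp only: minus_add_distrib diff_conv_add_uminus add.commute)
  finally show ?thesis
    by (simp only: minus_divide_divide)
qed

section \<open>Fermionic integrals of exponentials\<close>

context padic_field
begin

text \<open>Otherwise \<open>b - 1 = -2\<close>, which has absolute value 1 because \<open>p\<close>
  is odd.\<close>

lemma one_plus_disc_nonzero:
  assumes "odd p" and "absval (b - 1 :: 'a) < rad"
  shows "1 + b \<noteq> 0"
proof
  assume "1 + b = 0"
  then have "b - 1 = - of_nat 2"
    by (simp add: eq_neg_iff_add_eq_0 algebra_simps)
  moreover have "\<not> p dvd 2"
    using assms(1) prime_p primes_dvd_imp_eq[of p 2] by auto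
  ultimately have "absval (b - 1) = 1"
    using absval_of_nat_coprime by (simp only: absval_minus not_False_eq_True)
  then show False
    using assms(2) rad_lt_1 by simp
qed

text \<open>The integrand is prescribed at natural numbers only, since these are the points at which
  the defining sums sample it.\<close>

lemma fermionic_integral_exponential:
  fixes Q :: 'a and a c :: "'b \<Rightarrow> 'a"
  assumes "odd p" and Q: "absval (Q - 1) < rad"
    and a: "\<And>s. s \<in> S \<Longrightarrow> absval (Q * a s - 1) < rad"
    and f: "\<And>x. f (of_nat x) = (\<Sum>s\<in>S. c s * a s ^ x)"
  shows "fermionic_integral p Q f = (\<Sum>s\<in>S. c s * ((1 + Q) / (1 + Q * a s)))"
proof -
  have eq: "(1 + Q) / (1 + Q ^ (p ^ N)) * (\<Sum>x<p ^ N. f (of_nat x) * (- 1) ^ x * Q ^ x)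
      = (\<Sum>s\<in>S. c s * ((1 + Q) * inverse (1 + Q ^ (p ^ N)) *
            ((1 + (Q * a s) ^ (p ^ N)) * inverse (1 + Q * a s))))" for N
  proof -
    have "(\<Sum>x<p ^ N. f (of_nat x) * (- 1) ^ x * Q ^ x)
        = (\<Sum>x<p ^ N. \<Sum>s\<in>S. c s * (- (Q * a s)) ^ x)"
      unfolding f sum_distrib_right
      by (intro sum.cong refl) (simp add: power_minus[of "Q * _"] power_mult_distrib)
    also have "\<dots> = (\<Sum>s\<in>S. c s * (\<Sum>x<p ^ N. (- (Q * a s)) ^ x))"
      by (subst sum.swap) (simp add: sum_distrib_left)
    also have "\<dots> = (\<Sum>s\<in>S. c s * ((1 + (Q * a s) ^ (p ^ N)) / (1 + Q * a s)))"
      using assms(1) by (intro sum.cong refl arg_cong2[of _ _ _ _ "(*)"] alternating_geometric_sum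
          one_plus_disc_nonzero a) auto
    finally show ?thesis
      by (simp add: sum_distrib_left divide_inverse mult_ac)
  qed
  \<comment> \<open>Both \<open>Q ^ (p ^ N)\<close> and \<open>(Q * a s) ^ (p ^ N)\<close> tend to
    1, which produces the two factors \<open>1 + 1\<close> that cancel below.\<close>
  have "(\<lambda>N. (1 + Q) / (1 + Q ^ (p ^ N)) * (\<Sum>x<p ^ N. f (of_nat x) * (- 1) ^ x * Q ^ x))
      \<longlonglongrightarrow> (\<Sum>s\<in>S. c s * ((1 + Q) * inverse (1 + 1) * ((1 + 1) * inverse (1 + Q * a s))))"
    unfolding eq by (intro tendsto_intros tendsto_inverse_nonarch power_p_power_LIMSEQ Q a) auto
  then have "fermionic_integral p Q f
      = (\<Sum>s\<in>S. c s * ((1 + Q) * inverse (1 + 1) * ((1 + 1) * inverse (1 + Q * a s))))"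
    unfolding fermionic_integral_def by (rule limI)
  also have "\<dots> = (\<Sum>s\<in>S. c s * ((1 + Q) / (1 + Q * a s)))"
  proof (intro sum.cong refl)
    fix s
    have "inverse (1 + 1) * (1 + 1) = (1 :: 'a)"
      by simp
    then show "c s * ((1 + Q) * inverse (1 + 1) * ((1 + 1) * inverse (1 + Q * a s)))
        = c s * ((1 + Q) / (1 + Q * a s))"
      unfolding divide_inverse by (metis mult.assoc mult_1_left)
  qed
  finally show ?thesis .
qed

text \<open>The induction peels off the outermost variable \<open>x (Suc k)\<close>. Fixing it at
  \<open>t\<close> multiplies the coefficients by \<open>a s (Suc k) ^ t\<close>, hence
  \<open>c\<close> is generalized along with \<open>F\<close>.\<close>

lemma iterated_integral_exponential:
  fixes Q :: 'a and a :: "'b \<Rightarrow> nat \<Rightarrow> 'a" and c :: "'b \<Rightarrow> 'a"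
  assumes "odd p" and "absval (Q - 1) < rad"
    and "\<And>s j. s \<in> S \<Longrightarrow> absval (Q * a s j - 1) < rad"
    and "\<And>n. F (\<lambda>j. of_nat (n j)) = (\<Sum>s\<in>S. c s * (\<Prod>j=1..k. a s j ^ n j))"
  shows "iterated_integral p Q k F = (\<Sum>s\<in>S. c s * (\<Prod>j=1..k. (1 + Q) / (1 + Q * a s j)))"
  using assms(4)
proof (induction k arbitrary: F c)
  case 0
  show ?case
    using "0.prems"[of "\<lambda>_. 0"] by simp
next
  case (Suc k)
  have inner: "iterated_integral p Q k (\<lambda>x. F (x(Suc k := of_nat t)))
      = (\<Sum>s\<in>S. (c s * (\<Prod>j=1..k. (1 + Q) / (1 + Q * a s j))) * a s (Suc k) ^ t)" for t
  proof -
    have "F ((\<lambda>j. of_nat (n j))(Suc k := of_nat t))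
        = (\<Sum>s\<in>S. (c s * a s (Suc k) ^ t) * (\<Prod>j=1..k. a s j ^ n j))" for n
    proof -
      have "(\<lambda>j. of_nat (n j))(Suc k := of_nat t) = (\<lambda>j. of_nat ((n(Suc k := t)) j) :: 'a)"
        by auto
      then show ?thesis
        using Suc.prems[of "n(Suc k := t)"] by (simp add: mult_ac)
    qed
    then show ?thesis
      by (subst Suc.IH[where c = "\<lambda>s. c s * a s (Suc k) ^ t"]) (simp_all add: mult_ac)
  qed
  have "iterated_integral p Q (Suc k) F
      = (\<Sum>s\<in>S. (c s * (\<Prod>j=1..k. (1 + Q) / (1 + Q * a s j))) * ((1 + Q) / (1 + Q * a s (Suc k))))"
    unfolding iterated_integral.simps
    by (rule fermionic_integral_exponential) (use assms inner in auto)
  then show ?case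
    by (simp add: mult.assoc)
qed

section \<open>Powers with \<open>p\<close>-adic exponents and the closed form\<close>

lemma Qpow_add_of_int:
  fixes Q :: 'a
  assumes Q: "absval (Q - 1) < rad" and y: "absval (y * Cp_log Q) < rad"
  shows "Qpow Q (y + of_int n) = Qpow Q y * Q powi n"
proof -
  have L: "absval (Cp_log Q) < rad"
    by (rule absval_Cp_log_less[OF Q])
  have "Qpow Q (y + of_int n) = Cp_exp (y * Cp_log Q + of_int n * Cp_log Q)"
    by (simp add: Qpow_def distrib_right)
  also have "\<dots> = Qpow Q y * Cp_exp (of_int n * Cp_log Q)"
    unfolding Qpow_def by (intro Cp_exp_add absval_of_int_mult_less y L)
  finally show ?thesis
    by (simp add: Cp_exp_of_int_mult[OF L] Cp_exp_log[OF Q])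
qed

lemma Qpow_of_int:
  fixes Q :: 'a
  assumes "absval (Q - 1) < rad"
  shows "Qpow Q (of_int n) = Q powi n"
  using Qpow_add_of_int[OF assms, of 0 n] rad_pos by (simp add: Qpow_def)

lemma qEuler_closed_form:
  fixes Q y :: 'a
  assumes "odd p" and Q: "absval (Q - 1) < rad" and y: "absval (y * Cp_log Q) < rad"
  shows "qEuler p Q h k m y =
    (\<Sum>s\<le>m. inverse (1 - Q) ^ m * of_nat (m choose s) * (- Qpow Q y) ^ s *
       (\<Prod>j=1..k. (1 + Q) / (1 + Q powi (h - int j + 1 + int s))))"
proof -
  have Q0: "Q \<noteq> 0"
    using absval_eq_1_of_disc[OF Q] by auto
  \<comment> \<open>The base of the exponential in the variable \<open>j\<close>: the weight
    contributes \<open>h - j\<close> to the exponent and the \<open>s\<close>-th binomial term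
    contributes \<open>s\<close>. The measure adds the remaining 1 in \<open>Qa\<close>.\<close>
  define a where "a s j = Q powi (h - int j + int s)" for s j
  define c where "c s = inverse (1 - Q) ^ m * of_nat (m choose s) * (- Qpow Q y) ^ s" for s
  have Qa: "Q * a s j = Q powi (h - int j + 1 + int s)" for s j
  proof -
    have "Q * a s j = Q powi (1 + (h - int j + int s))"
      unfolding a_def using Q0 by (simp add: power_int_add)
    then show ?thesis
      by (simp add: algebra_simps)
  qed
  have F: "Qbracket Q (y + (\<Sum>j=1..k. of_nat (n j))) ^ m *
          Qpow Q (\<Sum>j=1..k. of_int (h - int j) * of_nat (n j))
      = (\<Sum>s\<in>{..m}. c s * (\<Prod>j=1..k. a s j ^ n j))" for n
  proof -
    have "Qpow Q (\<Sum>j=1..k. of_int (h - int j) * of_nat (n j))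
        = Qpow Q (of_int (\<Sum>j=1..k. (h - int j) * int (n j)))"
      by simp
    also have "\<dots> = (\<Prod>j=1..k. (Q powi (h - int j)) ^ n j)"
      unfolding Qpow_of_int[OF Q] power_int_sum[OF Q0] by (simp add: power_int_mult)
    finally have 1: "Qpow Q (\<Sum>j=1..k. of_int (h - int j) * of_nat (n j))
        = (\<Prod>j=1..k. (Q powi (h - int j)) ^ n j)" .
    have "Qpow Q (y + (\<Sum>j=1..k. of_nat (n j))) = Qpow Q (y + of_int (\<Sum>j=1..k. int (n j)))"
      by simp
    also have "\<dots> = Qpow Q y * (\<Prod>j=1..k. Q ^ n j)"
      unfolding Qpow_add_of_int[OF Q y] power_int_sum[OF Q0] by simp
    finally have "Qbracket Q (y + (\<Sum>j=1..k. of_nat (n j))) ^ m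
        = inverse (1 - Q) ^ m * (- Qpow Q y * (\<Prod>j=1..k. Q ^ n j) + 1) ^ m"
      by (simp add: Qbracket_def divide_inverse power_mult_distrib mult.commute)
    also have "\<dots> = (\<Sum>s\<le>m. c s * (\<Prod>j=1..k. Q ^ n j) ^ s)"
      by (simp only: binomial_ring power_one mult_1_right sum_distrib_left power_mult_distrib c_def mult.assoc)
    finally have 2: "Qbracket Q (y + (\<Sum>j=1..k. of_nat (n j))) ^ m
        = (\<Sum>s\<le>m. c s * (\<Prod>j=1..k. Q ^ n j) ^ s)" .
    have "(\<Prod>j=1..k. Q ^ n j) ^ s * (\<Prod>j=1..k. (Q powi (h - int j)) ^ n j)
        = (\<Prod>j=1..k. a s j ^ n j)" for s
      unfolding prod_power_distrib prod.distrib[symmetric] a_def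
    proof (intro prod.cong refl)
      fix j
      have "(Q ^ n j) ^ s = (Q ^ s) ^ n j"
        by (metis mult.commute power_mult)
      then show "(Q ^ n j) ^ s * (Q powi (h - int j)) ^ n j = (Q powi (h - int j + int s)) ^ n j"
        using Q0 by (simp add: power_int_add power_mult_distrib)
    qed
    then show ?thesis
      unfolding 1 2 sum_distrib_right by (simp only: mult.assoc)
  qed
  show ?thesis
    unfolding qEuler_def Qa[symmetric] c_def[symmetric]
    by (rule iterated_integral_exponential)
      (use assms(1) Q F in \<open>auto simp: Qa intro: disc_power_int\<close>)
qed

end

section \<open>The distribution relation by comparison of coefficients\<close>

theorem theorem6:
  fixes p l k m :: nat and h :: int and q x :: "'a::nonarch_complete_field"
  assumes "prime p" and "odd p"
    and "is_Cp p TYPE('a)"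
    and "absval (1 - q) < real p powr (- 1 / (real p - 1))"
    and "odd l"
    and "x \<in> Zp"
  shows "qEuler p q h k m (of_nat l * x) =
    Qbracket q (of_nat l) ^ m / Qbracket_neg q l ^ k *
    (\<Sum>i \<in> {1..k} \<rightarrow>\<^sub>E {0..<l}.
       q powi (h * (\<Sum>j=1..k. int (i j)) - (\<Sum>j=2..k. (int j - 1) * int (i j))) *
       (-1) ^ (\<Sum>j=1..k. i j) *
       qEuler p (q ^ l) h k m (x + of_nat (\<Sum>j=1..k. i j) / of_nat l))"
proof -
  interpret padic_field p "TYPE('a)"
    using assms(1,3) by unfold_locales (auto simp: is_Cp_def)
  have q: "absval (q - 1) < rad"
    using assms(4) absval_minus_commute[of 1 q] by (simp add: rad_def)
  have q0: "q \<noteq> 0"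
    using absval_eq_1_of_disc[OF q] by auto
  have ql: "absval (q ^ l - 1) < rad"
    by (rule disc_power[OF q])
  have l0: "(of_nat l :: 'a) \<noteq> 0"
    using assms(5) by (auto elim: oddE)
  have L: "absval (Cp_log q) < rad"
    by (rule absval_Cp_log_less[OF q])
  have "absval x \<le> 1"
    using assms(6) by (simp add: Zp_def)
  then have "absval (x * (of_nat l * Cp_log q)) \<le> 1 * absval (of_nat l * Cp_log q)"
    unfolding absval_mult[of x] by (intro mult_right_mono) auto
  then have y: "absval (of_nat l * x * Cp_log q) < rad"
    using absval_of_nat_mult_less[OF L, of l] by (simp add: mult_ac)
  define Y where "Y = Qpow q (of_nat l * x)"
  \<comment> \<open>These are the quantities in the denominators of the closed form for
    \<open>q\<close>; passing to \<open>q ^ l\<close> replaces them by their \<open>l\<close>-th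
    powers.\<close>
  define b where "b s j = q powi (h - int j + 1 + int s)" for s j
  have b1: "1 + b s j \<noteq> 0" for s j
    unfolding b_def by (intro one_plus_disc_nonzero assms(2) disc_power_int q)
  have bl1: "1 + b s j ^ l \<noteq> 0" for s j
    unfolding b_def by (intro one_plus_disc_nonzero assms(2) disc_power disc_power_int q)
  have ql1: "1 + q ^ l \<noteq> 0" and q1: "1 + q \<noteq> 0"
    by (intro one_plus_disc_nonzero assms(2) q ql)+
  have bl: "(q ^ l) powi (h - int j + 1 + int s) = b s j ^ l" for s j
    unfolding b_def by (metis mult.commute power_int_mult power_int_of_nat)
  define D where "D s = inverse (1 - q ^ l) ^ m * of_nat (m choose s) * (- Y) ^ s *
       (\<Prod>j=1..k. (1 + q ^ l) / (1 + b s j ^ l))" for s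
  have E: "qEuler p (q ^ l) h k m (x + of_nat n / of_nat l) = (\<Sum>s\<le>m. D s * (q ^ n) ^ s)" for n
  proof -
    \<comment> \<open>Since the logarithm of \<open>q ^ l\<close> is \<open>l\<close> times that of
      \<open>q\<close>, the fraction \<open>n / l\<close> turns into the integer shift
      \<open>n\<close> for base \<open>q\<close>.\<close>
    have arg: "(x + of_nat n / of_nat l) * Cp_log (q ^ l) = (of_nat l * x + of_int (int n)) * Cp_log q"
      unfolding Cp_log_power[OF q] using l0 by (simp add: field_simps)
    have "absval ((of_nat l * x + of_int (int n)) * Cp_log q) < rad"
      unfolding distrib_right
      using absval_add[of "of_nat l * x * Cp_log q" "of_int (int n) * Cp_log q"]
        y absval_of_int_mult_less[OF L, of "int n"] by linarith
    then have "absval ((x + of_nat n / of_nat l) * Cp_log (q ^ l)) < rad"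
      unfolding arg .
    moreover have "Qpow (q ^ l) (x + of_nat n / of_nat l) = Y * q ^ n"
    proof -
      have "Qpow (q ^ l) (x + of_nat n / of_nat l) = Qpow q (of_nat l * x + of_int (int n))"
        unfolding Qpow_def arg ..
      then show ?thesis
        unfolding Qpow_add_of_int[OF q y] Y_def by simp
    qed
    ultimately have "qEuler p (q ^ l) h k m (x + of_nat n / of_nat l)
        = (\<Sum>s\<le>m. inverse (1 - q ^ l) ^ m * of_nat (m choose s) * (- Y * q ^ n) ^ s *
            (\<Prod>j=1..k. (1 + q ^ l) / (1 + b s j ^ l)))"
      by (simp add: qEuler_closed_form[OF assms(2) ql] bl)
    then show ?thesis
      by (simp only: D_def power_mult_distrib mult_ac)
  qed
  \<comment> \<open>Everything that depends on the tuple \<open>i\<close> splits into one factor per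
    \<open>j\<close>; the power \<open>q^(s i_j)\<close> from the shift raises the exponent to that
    of \<open>b s j\<close>.\<close>
  have weight: "q powi (h * (\<Sum>j=1..k. int (i j)) - (\<Sum>j=2..k. (int j - 1) * int (i j))) *
       (-1) ^ (\<Sum>j=1..k. i j) * (q ^ (\<Sum>j=1..k. i j)) ^ s = (\<Prod>j=1..k. (- b s j) ^ i j)"
    for i :: "nat \<Rightarrow> nat" and s
  proof -
    \<comment> \<open>The added term \<open>j = 1\<close> has coefficient 0.\<close>
    have "(\<Sum>j=2..k. (int j - 1) * int (i j)) = (\<Sum>j=1..k. (int j - 1) * int (i j))"
      by (rule sum.mono_neutral_left) auto
    then have "h * (\<Sum>j=1..k. int (i j)) - (\<Sum>j=2..k. (int j - 1) * int (i j))
        = (\<Sum>j=1..k. (h - int j + 1) * int (i j))"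
      by (simp add: sum_distrib_left sum_subtractf[symmetric] algebra_simps)
    then have 1: "q powi (h * (\<Sum>j=1..k. int (i j)) - (\<Sum>j=2..k. (int j - 1) * int (i j)))
        = (\<Prod>j=1..k. (q powi (h - int j + 1)) ^ i j)"
      by (simp add: power_int_sum[OF q0] power_int_mult)
    show ?thesis
      unfolding 1 power_sum prod_power_distrib prod.distrib[symmetric] b_def
    proof (intro prod.cong refl)
      fix j
      have "q powi (h - int j + 1 + int s) = q powi (h - int j + 1) * q ^ s"
        using q0 by (simp add: power_int_add)
      moreover have "(q ^ i j) ^ s = (q ^ s) ^ i j"
        by (metis mult.commute power_mult)
      ultimately show "(q powi (h - int j + 1)) ^ i j * (- 1) ^ i j * (q ^ i j) ^ s
          = (- (q powi (h - int j + 1 + int s))) ^ i j"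
        by (simp only: power_minus[of "_ * _"] power_mult_distrib mult_ac)
    qed
  qed
  have "(\<Sum>i \<in> {1..k} \<rightarrow>\<^sub>E {0..<l}.
       q powi (h * (\<Sum>j=1..k. int (i j)) - (\<Sum>j=2..k. (int j - 1) * int (i j))) *
       (-1) ^ (\<Sum>j=1..k. i j) *
       qEuler p (q ^ l) h k m (x + of_nat (\<Sum>j=1..k. i j) / of_nat l))
     = (\<Sum>i \<in> {1..k} \<rightarrow>\<^sub>E {0..<l}. \<Sum>s\<le>m. D s * (\<Prod>j=1..k. (- b s j) ^ i j))"
    unfolding E sum_distrib_left weight[symmetric] by (intro sum.cong refl) (simp only: mult_ac)
  \<comment> \<open>Distributivity: a sum over tuples of a product over \<open>j\<close> is a
    product of \<open>k\<close> sums.\<close>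
  also have "\<dots> = (\<Sum>s\<le>m. D s * (\<Prod>j=1..k. \<Sum>n<l. (- b s j) ^ n))"
    by (subst sum.swap) (simp add: sum_distrib_left prod_sum_PiE atLeast0LessThan)
  also have "\<dots> = (\<Sum>s\<le>m. inverse (1 - q ^ l) ^ m * of_nat (m choose s) * (- Y) ^ s *
       (\<Prod>j=1..k. (1 + q ^ l) / (1 + b s j)))"
  proof (intro sum.cong refl)
    fix s
    \<comment> \<open>The numerator \<open>1 + b s j ^ l\<close> of the geometric sum cancels the
      denominator coming from the closed form for \<open>q ^ l\<close>.\<close>
    have "(\<Prod>j=1..k. (1 + q ^ l) / (1 + b s j ^ l)) * (\<Prod>j=1..k. \<Sum>n<l. (- b s j) ^ n)
        = (\<Prod>j=1..k. (1 + q ^ l) / (1 + b s j))"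
      unfolding prod.distrib[symmetric] alternating_geometric_sum[OF b1 assms(5)]
      using bl1 by simp
    then show "D s * (\<Prod>j=1..k. \<Sum>n<l. (- b s j) ^ n) = inverse (1 - q ^ l) ^ m * of_nat (m choose s)
        * (- Y) ^ s * (\<Prod>j=1..k. (1 + q ^ l) / (1 + b s j))"
      unfolding D_def by (simp only: mult.assoc)
  qed
  finally have rhs: "(\<Sum>i \<in> {1..k} \<rightarrow>\<^sub>E {0..<l}.
       q powi (h * (\<Sum>j=1..k. int (i j)) - (\<Sum>j=2..k. (int j - 1) * int (i j))) *
       (-1) ^ (\<Sum>j=1..k. i j) *
       qEuler p (q ^ l) h k m (x + of_nat (\<Sum>j=1..k. i j) / of_nat l))
     = (\<Sum>s\<le>m. inverse (1 - q ^ l) ^ m * of_nat (m choose s) * (- Y) ^ s *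
       (\<Prod>j=1..k. (1 + q ^ l) / (1 + b s j)))" .
  have Ql: "Qbracket q (of_nat l) = (1 - q ^ l) / (1 - q)"
    using Qpow_of_int[OF q, of "int l"] by (simp add: Qbracket_def)
  have Qinv: "Qbracket q (of_nat l) * inverse (1 - q ^ l) = inverse (1 - q)"
  \<comment> \<open>For \<open>q = 1\<close> both sides are 0 by the convention for division by 0.
    Otherwise \<open>q\<close> is not an \<open>l\<close>-th root of unity, as the logarithm has
    trivial kernel.\<close>
  proof (cases "q = 1")
    case True
    then show ?thesis
      by (simp add: Ql)
  next
    case False
    have "q ^ l \<noteq> 1"
    proof
      assume "q ^ l = 1"
      then have "of_nat l * Cp_log q = 0"
        \<comment> \<open>The instance with exponent 0 supplies \<open>Cp_log 1 = 0\<close>.\<close>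
        using Cp_log_power[OF q, of l] Cp_log_power[OF q, of 0] by simp
      then show False
        using l0 Cp_log_eq_0_imp[OF q] False by simp
    qed
    then show ?thesis
      by (simp add: Ql field_simps)
  qed
  have Qneg: "Qbracket_neg q l = (1 + q ^ l) / (1 + q)"
    using assms(5) by (simp add: Qbracket_neg_def power_minus_odd)
  have "qEuler p q h k m (of_nat l * x) = (\<Sum>s\<le>m. inverse (1 - q) ^ m * of_nat (m choose s) * (- Y) ^ s *
       (\<Prod>j=1..k. (1 + q) / (1 + b s j)))"
    unfolding qEuler_closed_form[OF assms(2) q y] Y_def b_def ..
  \<comment> \<open>\<open>Qinv\<close> accounts for the \<open>m\<close>-th power of
    \<open>Qbracket\<close>; each of the \<open>k\<close> factors \<open>1 + q\<close> equals
    \<open>1 + q ^ l\<close> divided by \<open>Qbracket_neg q l\<close>.\<close>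
  also have "\<dots> = Qbracket q (of_nat l) ^ m / Qbracket_neg q l ^ k *
     (\<Sum>s\<le>m. inverse (1 - q ^ l) ^ m * of_nat (m choose s) * (- Y) ^ s *
       (\<Prod>j=1..k. (1 + q ^ l) / (1 + b s j)))"
    unfolding sum_distrib_left
  proof (intro sum.cong refl)
    fix s
    have "(\<Prod>j=1..k. (1 + q) / (1 + b s j))
        = (\<Prod>j=1..k. inverse (Qbracket_neg q l) * ((1 + q ^ l) / (1 + b s j)))"
      using ql1 q1 by (intro prod.cong refl) (simp add: Qneg)
    also have "\<dots> = inverse (Qbracket_neg q l ^ k) * (\<Prod>j=1..k. (1 + q ^ l) / (1 + b s j))"
      by (simp only: prod.distrib prod_constant card_atLeastAtMost power_inverse) simp
    finally show "inverse (1 - q) ^ m * of_nat (m choose s) * (- Y) ^ s *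
         (\<Prod>j=1..k. (1 + q) / (1 + b s j))
       = Qbracket q (of_nat l) ^ m / Qbracket_neg q l ^ k *
         (inverse (1 - q ^ l) ^ m * of_nat (m choose s) * (- Y) ^ s *
           (\<Prod>j=1..k. (1 + q ^ l) / (1 + b s j)))"
      unfolding Qinv[symmetric] power_mult_distrib by (simp only: divide_inverse mult_ac)
  qed
  finally show ?thesis
    unfolding rhs .
qed

end
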